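(* In the setting described in the context, let $(u_h^k,\psi_h^k)_{k\ge1}$ be the proximal Galerkin iterates with energy $E(v)=\tfrac12a(v,v)-F(v)$. Then for all $k\ge1$, $$E(u_h^{k+1})+\frac1{\alpha_{k+1}}\big(\mathcal D^*(\psi_h^{k+1},\psi_h^k)+\mathcal D^*(\psi_h^k,\psi_h^{k+1}),1\big)_{\Omega_d}\le E(u_h^k).$$
   Context: Setting. $\Omega\subset\mathbb R^n$ ($n\in\{1,2,3\}$) is an open bounded polygonal/polyhedral domain. $\Omega_d\subset\overline\Omega$ is a Hausdorff-measurable set of Hausdorff dimension $d\le n$ with Hausdorff measure $\mathcal H_d$ (coinciding with the induced surface measure), and $(\cdot,\cdot)_{\Omega_d}$ is the $L^2(\Omega_d)$ inner product. $V$ is a real Hilbert space with dual $V'$; $B:V\to Q$ is a surjective bounded linear map whose image $Q$ (a Hilbert space) is continuously and densely embedded in $L^2(\Omega_d;\mathbb R^m)$. For a.e. $x\in\Omega_d$, $C(x)\subset\mathbb R^m$ is a closed convex set with nonempty interior. Set $\mathcal O=\{o\in L^2(\Omega_d;\mathbb R^m): o(x)\in C(x)\text{ for a.e. }x\in\Omega_d\}$. The bilinear form $a$ on $V$ is symmetric with $a(u,u)\ge\nu\|u\|_V^2$ and $a(u,v)\le M\|u\|_V\|v\|_V$ for constants $\nu,M>0$; $F\in V'$. Let $W=L^\infty(\Omega_d;\mathbb R^m)$, regarded as a subset of $Q'$ via $\langle w,q\rangle=(w,q)_{\Omega_d}$, and $b(v,w)=(Bv,w)_{\Omega_d}$. Legendre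 function. A function $L:\mathbb R^m\to\mathbb R\cup\{+\infty\}$ is Legendre if it is proper with $\operatorname{int}(\operatorname{dom}L)\ne\emptyset$, strictly convex and differentiable on $\operatorname{int}(\operatorname{dom}L)$, with singular gradient on the boundary of $\operatorname{dom}L$. Let $R:\Omega_d\times\mathbb R^m\to\mathbb R\cup\{+\infty\}$ be Carathéodory with $R(x,\cdot)$ Legendre, $\operatorname{dom}R(x,\cdot)=C(x)$, and $R(x,y)/|y|\to\infty$ as $|y|\to\infty$, for a.e. $x$. Put $\mathcal R(w)(x)=R(x,w(x))$ and assume $\mathcal R:\mathcal O\to L^1(\Omega_d)$ is continuous ($\mathcal O$ with the $L^2$ topology). Let $R^*(x,z)=\sup_{y\in\mathbb R^m}\{z\cdot y-R(x,y)\}$, $\mathcal R^*(\psi)(x)=R^*(x,\psi(x))$, $\nabla\mathcal R^*(\psi)(x)=\partial_zR^*(x,\psi(x))$. Then $\mathcal R^*:W\to L^1(\Omega_d)$ and $\nabla\mathcal R^*:W\to\mathcal O$ is continuous. The dual Bregman divergence is $$\mathcal D^*(\eta,\psi)=\mathcal R^*(\eta)-\mathcal R^*(\psi)-\nabla\mathcal R^*(\psi)\cdot(\eta-\psi).$$ Discrete spaces and iterates. $V_h\subset V$ and $W_h\subset W$ are finite-dimensional subspaces satisfying $\inf_{w\in W_h}\sup_{v\in V_h}\frac{b(v,w)}{\|v\|_V\|w\|_{Q'}}=\beta_h>\beta_0>0$ with $\beta_0$ mesh-independent. Given $\psi_h^0\in W_h$ and positive parameters $\{\alpha_k\}$ with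 $\sum_k\alpha_k=\infty$, the proximal Galerkin iterates $(u_h^k,\psi_h^k)\in V_h\times W_h$, $k\ge1$, are the (unique) solutions of $$\alpha_k a(u_h^k,v_h)+b(v_h,\psi_h^k-\psi_h^{k-1})=\alpha_kF(v_h)\ \ \forall v_h\in V_h,\qquad b(u_h^k,w_h)-(\nabla\mathcal R^*(\psi_h^k),w_h)_{\Omega_d}=0\ \ \forall w_h\in W_h.$$ *)

theory Defs
  imports "HOL-Probability.Essential_Supremum"
begin

subsection \<open>Hausdorff measure and dimension\<close>

text \<open>The normalisation by the volume of the unit ball makes the measure agree with Lebesgue
  measure and with surface measure in integer dimensions. The case \<open>s = 0\<close> is separate because
  \<open>0 powr 0 = 0\<close>, whereas nonempty sets must have weight 1 in dimension 0.\<close>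

definition hausdorff_gauge :: "real \<Rightarrow> 'a::metric_space set \<Rightarrow> real" where
  "hausdorff_gauge s U =
     (if U = {} then 0 else if s = 0 then 1 else unit_ball_vol s * (diameter U / 2) powr s)"

text \<open>Boundedness is required explicitly since \<open>diameter\<close> is unspecified on unbounded sets.\<close>

definition fine_covers :: "real \<Rightarrow> 'a::metric_space set \<Rightarrow> (nat \<Rightarrow> 'a set) set" where
  "fine_covers \<delta> A = {U. A \<subseteq> (\<Union>i. U i) \<and> (\<forall>i. bounded (U i) \<and> diameter (U i) \<le> \<delta>)}"

definition hausdorff_premeasure :: "real \<Rightarrow> real \<Rightarrow> 'a::metric_space set \<Rightarrow> ennreal" where
  "hausdorff_premeasure s \<delta> A = (INF U\<in>fine_covers \<delta> A. \<Sum>i. ennreal (hausdorff_gauge s (U i)))"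

definition hausdorff_outer :: "real \<Rightarrow> 'a::metric_space set \<Rightarrow> ennreal" where
  "hausdorff_outer s A = (SUP \<delta>\<in>{0<..}. hausdorff_premeasure s \<delta> A)"

definition hausdorff_measure :: "real \<Rightarrow> 'a::metric_space measure" where
  "hausdorff_measure s =
     measure_of UNIV (lambda_system UNIV (Pow UNIV) (hausdorff_outer s)) (hausdorff_outer s)"

definition hausdorff_dim :: "'a::metric_space set \<Rightarrow> real" where
  "hausdorff_dim A = Inf {s. 0 \<le> s \<and> hausdorff_outer s A = 0}"

lemma hausdorff_premeasure_mono:
  "A \<subseteq> B \<Longrightarrow> hausdorff_premeasure s \<delta> A \<le> hausdorff_premeasure s \<delta> B"
  unfolding hausdorff_premeasure_def by (rule INF_superset_mono) (auto simp: fine_covers_def)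

lemma hausdorff_premeasure_empty:
  assumes "0 < \<delta>" shows "hausdorff_premeasure s \<delta> ({}::'a::metric_space set) = 0"
proof -
  have "(\<lambda>_. {}) \<in> fine_covers \<delta> ({}::'a set)"
    using assms by (simp add: fine_covers_def)
  then have "hausdorff_premeasure s \<delta> ({}::'a set) \<le> (\<Sum>i::nat. ennreal (hausdorff_gauge s ({}::'a set)))"
    unfolding hausdorff_premeasure_def by (rule INF_lower2) simp
  then show ?thesis by (simp add: hausdorff_gauge_def)
qed

lemma hausdorff_premeasure_UN:
  fixes A :: "nat \<Rightarrow> 'a::metric_space set"
  shows "hausdorff_premeasure s \<delta> (\<Union>i. A i) \<le> (\<Sum>i. hausdorff_premeasure s \<delta> (A i))"
proof (rule ennreal_le_epsilon)
  let ?P = "hausdorff_premeasure s \<delta> :: 'a set \<Rightarrow> ennreal"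
  let ?g = "\<lambda>U::'a set. ennreal (hausdorff_gauge s U)"
  fix e :: real assume e: "0 < e" and fin: "(\<Sum>n. ?P (A n)) < top"
  have *: "?P (A n) < ?P (A n) + e * (1/2)^Suc n" for n
    using e fin by (auto simp add: less_top dest!: ennreal_suminf_lessD)
  have "\<exists>U. U \<in> fine_covers \<delta> (A n) \<and> (\<Sum>i. ?g (U i)) \<le> ?P (A n) + e * (1/2)^Suc n" for n
    using *[of n] unfolding hausdorff_premeasure_def INF_less_iff by (auto intro: less_imp_le)
  then obtain B where B: "\<And>n. B n \<in> fine_covers \<delta> (A n)"
    and Ble: "\<And>n. (\<Sum>i. ?g (B n i)) \<le> ?P (A n) + e * (1/2)^Suc n"
    by metis
  define C where "C = case_prod B o prod_decode"
  have "(\<Union>i. A i) \<subseteq> (\<Union>i. C i)"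
    using B by (auto simp: C_def fine_covers_def subset_eq) (metis prod.case prod_encode_inverse)
  then have "C \<in> fine_covers \<delta> (\<Union>i. A i)"
    using B by (auto simp: C_def fine_covers_def split_def)
  then have "?P (\<Union>i. A i) \<le> (\<Sum>i. ?g (C i))"
    unfolding hausdorff_premeasure_def by (rule INF_lower)
  also have "\<dots> = (\<Sum>n. \<Sum>i. ?g (B n i))"
    unfolding C_def comp_def by (intro suminf_ennreal_2dimen) auto
  also have "\<dots> \<le> (\<Sum>n. ?P (A n) + e * (1/2) ^ Suc n)"
    by (intro suminf_le allI Ble) auto
  also have "\<dots> = (\<Sum>n. ?P (A n)) + (\<Sum>n. ennreal e * ennreal ((1/2) ^ Suc n))"
    using e by (subst suminf_add[symmetric])
      (auto simp del: ennreal_suminf_cmult simp add: ennreal_mult[symmetric])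
  also have "\<dots> = (\<Sum>n. ?P (A n)) + e"
    unfolding ennreal_suminf_cmult
    by (subst suminf_ennreal_eq[OF zero_le_power power_half_series]) auto
  finally show "?P (\<Union>i. A i) \<le> (\<Sum>n. ?P (A n)) + e" .
qed

lemma outer_measure_space_hausdorff:
  "outer_measure_space (Pow UNIV) (hausdorff_outer s :: 'a::metric_space set \<Rightarrow> ennreal)"
  unfolding outer_measure_space_def
proof (intro conjI)
  show "positive (Pow UNIV) (hausdorff_outer s :: 'a set \<Rightarrow> ennreal)"
    by (auto simp: positive_def hausdorff_outer_def hausdorff_premeasure_empty)
  show "increasing (Pow UNIV) (hausdorff_outer s :: 'a set \<Rightarrow> ennreal)"
    by (auto simp: increasing_def hausdorff_outer_def intro!: SUP_mono'
          hausdorff_premeasure_mono)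
  show "countably_subadditive (Pow UNIV) (hausdorff_outer s :: 'a set \<Rightarrow> ennreal)"
    unfolding countably_subadditive_def
  proof (intro allI impI)
    fix A :: "nat \<Rightarrow> 'a set"
    show "hausdorff_outer s (\<Union>i. A i) \<le> (\<Sum>i. hausdorff_outer s (A i))"
      unfolding hausdorff_outer_def
    proof (rule SUP_least)
      fix \<delta> :: real assume "\<delta> \<in> {0<..}"
      have "hausdorff_premeasure s \<delta> (\<Union>i. A i) \<le> (\<Sum>i. hausdorff_premeasure s \<delta> (A i))"
        by (rule hausdorff_premeasure_UN)
      also have "\<dots> \<le> (\<Sum>i. SUP \<delta>\<in>{0<..}. hausdorff_premeasure s \<delta> (A i))"
        using \<open>\<delta> \<in> {0<..}\<close> by (intro suminf_le SUP_upper) auto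
      finally show "hausdorff_premeasure s \<delta> (\<Union>i. A i)
          \<le> (\<Sum>i. SUP \<delta>\<in>{0<..}. hausdorff_premeasure s \<delta> (A i))" .
    qed
  qed
qed

lemma measure_space_hausdorff:
  "measure_space UNIV (lambda_system UNIV (Pow UNIV) (hausdorff_outer s)) (hausdorff_outer s)"
  by (rule sigma_algebra.caratheodory_lemma[OF sigma_algebra_Pow outer_measure_space_hausdorff])

lemma sets_hausdorff_measure:
  "sets (hausdorff_measure s) = lambda_system UNIV (Pow UNIV) (hausdorff_outer s)"
  using measure_space_hausdorff[of s] sigma_algebra.sigma_sets_eq
  unfolding hausdorff_measure_def measure_space_def by (force simp: sets_measure_of)

lemma space_hausdorff_measure: "space (hausdorff_measure s) = UNIV"
  unfolding hausdorff_measure_def by (simp add: space_measure_of_conv)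

lemma emeasure_hausdorff_measure:
  "A \<in> sets (hausdorff_measure s) \<Longrightarrow> emeasure (hausdorff_measure s) A = hausdorff_outer s A"
  using measure_space_hausdorff[of s]
  by (subst hausdorff_measure_def, subst emeasure_measure_of_sigma)
     (auto simp: measure_space_def sets_hausdorff_measure)

subsection \<open>Polyhedral domains\<close>

definition polyhedral_domain :: "(real^'n) set \<Rightarrow> bool" where
  "polyhedral_domain \<Omega> \<longleftrightarrow> open \<Omega> \<and> connected \<Omega> \<and> \<Omega> \<noteq> {} \<and> bounded \<Omega> \<and>
     (\<exists>\<F>. finite \<F> \<and> (\<forall>P\<in>\<F>. polytope P \<and> aff_dim P = int CARD('n) - 1) \<and> frontier \<Omega> = \<Union>\<F>)"

subsection \<open>Lebesgue spaces\<close>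

text \<open>Elements of Lebesgue spaces are represented by functions; equality is equality
  almost everywhere, and the norms below are seminorms on representatives.\<close>

definition L2 :: "'x measure \<Rightarrow> ('x \<Rightarrow> 'a::euclidean_space) set" where
  "L2 M = {f \<in> borel_measurable M. integrable M (\<lambda>x. (norm (f x))\<^sup>2)}"

definition L2_inner :: "'x measure \<Rightarrow> ('x \<Rightarrow> 'a::euclidean_space) \<Rightarrow> ('x \<Rightarrow> 'a) \<Rightarrow> real" where
  "L2_inner M f g = (LINT x|M. f x \<bullet> g x)"

definition L2_dist :: "'x measure \<Rightarrow> ('x \<Rightarrow> 'a::euclidean_space) \<Rightarrow> ('x \<Rightarrow> 'a) \<Rightarrow> real" where
  "L2_dist M f g = sqrt (LINT x|M. (norm (f x - g x))\<^sup>2)"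

definition L1_dist :: "'x measure \<Rightarrow> ('x \<Rightarrow> real) \<Rightarrow> ('x \<Rightarrow> real) \<Rightarrow> real" where
  "L1_dist M f g = (LINT x|M. \<bar>f x - g x\<bar>)"

definition Linf :: "'x measure \<Rightarrow> ('x \<Rightarrow> 'a::euclidean_space) set" where
  "Linf M = {f \<in> borel_measurable M. esssup M (\<lambda>x. ereal (norm (f x))) < \<infinity>}"

definition Linf_dist :: "'x measure \<Rightarrow> ('x \<Rightarrow> 'a::euclidean_space) \<Rightarrow> ('x \<Rightarrow> 'a) \<Rightarrow> real" where
  "Linf_dist M f g = real_of_ereal (esssup M (\<lambda>x. ereal (norm (f x - g x))))"

definition continuous_wrt ::
  "('f \<Rightarrow> 'f \<Rightarrow> real) \<Rightarrow> ('g \<Rightarrow> 'g \<Rightarrow> real) \<Rightarrow> 'f set \<Rightarrow> ('f \<Rightarrow> 'g) \<Rightarrow> bool" where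
  "continuous_wrt dF dG S T \<longleftrightarrow>
     (\<forall>f\<in>S. \<forall>\<epsilon>>0. \<exists>\<delta>>0. \<forall>g\<in>S. dF g f < \<delta> \<longrightarrow> dG (T g) (T f) < \<epsilon>)"

text \<open>A continuous dense embedding of a normed space into \<open>L\<^sup>2\<close>; the map picks a representative of
  the image class, so linearity and injectivity hold up to null sets.\<close>

definition dense_embedding_L2 ::
  "'x measure \<Rightarrow> ('q::real_normed_vector \<Rightarrow> 'x \<Rightarrow> 'a::euclidean_space) \<Rightarrow> bool" where
  "dense_embedding_L2 M \<iota> \<longleftrightarrow>
     (\<forall>q. \<iota> q \<in> L2 M) \<and>
     (\<forall>p q. AE x in M. \<iota> (p + q) x = \<iota> p x + \<iota> q x) \<and>
     (\<forall>c q. AE x in M. \<iota> (c *\<^sub>R q) x = c *\<^sub>R \<iota> q x) \<and>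
     (\<forall>q. (AE x in M. \<iota> q x = 0) \<longrightarrow> q = 0) \<and>
     (\<exists>K. \<forall>q. L2_dist M (\<iota> q) (\<lambda>x. 0) \<le> K * norm q) \<and>
     (\<forall>f\<in>L2 M. \<forall>\<epsilon>>0. \<exists>q. L2_dist M f (\<iota> q) < \<epsilon>)"

text \<open>The norm in the dual of the embedded space of the functional induced by \<open>w\<close>.\<close>

definition dual_norm ::
  "'x measure \<Rightarrow> ('q::real_normed_vector \<Rightarrow> 'x \<Rightarrow> 'a::euclidean_space) \<Rightarrow> ('x \<Rightarrow> 'a) \<Rightarrow> real" where
  "dual_norm M \<iota> w = onorm (\<lambda>q. L2_inner M w (\<iota> q))"

text \<open>Closure under almost-everywhere equality makes the set a union of equivalence classes.\<close>

definition fin_dim_subspace_Linf ::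
  "'x measure \<Rightarrow> ('x \<Rightarrow> 'a::euclidean_space) set \<Rightarrow> bool" where
  "fin_dim_subspace_Linf M S \<longleftrightarrow>
     S \<subseteq> Linf M \<and> (\<lambda>x. 0) \<in> S \<and>
     (\<forall>f\<in>S. \<forall>g\<in>S. (\<lambda>x. f x + g x) \<in> S) \<and>
     (\<forall>c. \<forall>f\<in>S. (\<lambda>x. c *\<^sub>R f x) \<in> S) \<and>
     (\<forall>f\<in>S. \<forall>g\<in>Linf M. (AE x in M. f x = g x) \<longrightarrow> g \<in> S) \<and>
     (\<exists>\<Phi>\<subseteq>S. finite \<Phi> \<and> (\<forall>f\<in>S. \<exists>c. AE x in M. f x = (\<Sum>\<phi>\<in>\<Phi>. c \<phi> *\<^sub>R \<phi> x)))"

subsection \<open>Legendre functions, conjugates and Bregman divergence\<close>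

definition eff_dom :: "('a \<Rightarrow> ereal) \<Rightarrow> 'a set" where
  "eff_dom L = {y. L y < \<infinity>}"

definition gradient :: "('a::real_inner \<Rightarrow> real) \<Rightarrow> 'a \<Rightarrow> 'a" where
  "gradient f y = (THE g. GDERIV f y :> g)"

definition strictly_convex_on :: "'a::real_vector set \<Rightarrow> ('a \<Rightarrow> real) \<Rightarrow> bool" where
  "strictly_convex_on S f \<longleftrightarrow> convex S \<and>
     (\<forall>y\<in>S. \<forall>z\<in>S. \<forall>t. y \<noteq> z \<and> 0 < t \<and> t < 1 \<longrightarrow>
        f ((1 - t) *\<^sub>R y + t *\<^sub>R z) < (1 - t) * f y + t * f z)"

definition legendre :: "('a::euclidean_space \<Rightarrow> ereal) \<Rightarrow> bool" where
  "legendre L \<longleftrightarrow>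
     (\<forall>y. L y \<noteq> -\<infinity>) \<and> eff_dom L \<noteq> {} \<and> interior (eff_dom L) \<noteq> {} \<and>
     strictly_convex_on (interior (eff_dom L)) (\<lambda>y. real_of_ereal (L y)) \<and>
     (\<forall>y\<in>interior (eff_dom L). (\<lambda>y. real_of_ereal (L y)) differentiable (at y)) \<and>
     (\<forall>Y y. (\<forall>j. Y j \<in> interior (eff_dom L)) \<and> Y \<longlonglongrightarrow> y \<and> y \<in> frontier (eff_dom L) \<longrightarrow>
        filterlim (\<lambda>j. norm (gradient (\<lambda>y. real_of_ereal (L y)) (Y j))) at_top sequentially)"

definition supercoercive :: "('a::euclidean_space \<Rightarrow> ereal) \<Rightarrow> bool" where
  "supercoercive L \<longleftrightarrow> ((\<lambda>y. L y / ereal (norm y)) \<longlongrightarrow> \<infinity>) at_infinity"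

text \<open>Finite values on a closed proper subset and \<open>\<infinity>\<close> outside cannot be continuous
  on the whole space, so continuity in the second argument is continuity on the effective domain.\<close>

definition caratheodory_fun :: "'x measure \<Rightarrow> ('x \<Rightarrow> 'a::euclidean_space \<Rightarrow> ereal) \<Rightarrow> bool" where
  "caratheodory_fun M R \<longleftrightarrow>
     (\<forall>y. (\<lambda>x. R x y) \<in> borel_measurable M) \<and>
     (AE x in M. continuous_on (eff_dom (R x)) (R x))"

definition fenchel_conjugate :: "('a::real_inner \<Rightarrow> ereal) \<Rightarrow> 'a \<Rightarrow> ereal" where
  "fenchel_conjugate L z = (SUP y. ereal (z \<bullet> y) - L y)"

definition superpos :: "('x \<Rightarrow> 'a \<Rightarrow> ereal) \<Rightarrow> ('x \<Rightarrow> 'a) \<Rightarrow> 'x \<Rightarrow> real" where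
  "superpos R w x = real_of_ereal (R x (w x))"

text \<open>Because \<open>real_of_ereal\<close> sends \<open>\<plusminus>\<infinity>\<close> to 0, finiteness is part of being in \<open>L\<^sup>1\<close>.\<close>

definition superpos_in_L1 :: "'x measure \<Rightarrow> ('x \<Rightarrow> 'a \<Rightarrow> ereal) \<Rightarrow> ('x \<Rightarrow> 'a) \<Rightarrow> bool" where
  "superpos_in_L1 M R w \<longleftrightarrow>
     (AE x in M. \<bar>R x (w x)\<bar> \<noteq> \<infinity>) \<and> integrable M (superpos R w)"

definition conj_op :: "('x \<Rightarrow> 'a::real_inner \<Rightarrow> ereal) \<Rightarrow> ('x \<Rightarrow> 'a) \<Rightarrow> 'x \<Rightarrow> real" where
  "conj_op R = superpos (\<lambda>x. fenchel_conjugate (R x))"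

definition grad_conj_op ::
  "('x \<Rightarrow> 'a::real_inner \<Rightarrow> ereal) \<Rightarrow> ('x \<Rightarrow> 'a) \<Rightarrow> 'x \<Rightarrow> 'a" where
  "grad_conj_op R \<psi> x = gradient (\<lambda>z. real_of_ereal (fenchel_conjugate (R x) z)) (\<psi> x)"

definition dual_bregman ::
  "('x \<Rightarrow> 'a::real_inner \<Rightarrow> ereal) \<Rightarrow> ('x \<Rightarrow> 'a) \<Rightarrow> ('x \<Rightarrow> 'a) \<Rightarrow> 'x \<Rightarrow> real" where
  "dual_bregman R \<eta> \<psi> x =
     conj_op R \<eta> x - conj_op R \<psi> x - grad_conj_op R \<psi> x \<bullet> (\<eta> x - \<psi> x)"

definition feasible_obs :: "'x measure \<Rightarrow> ('x \<Rightarrow> 'a::euclidean_space set) \<Rightarrow> ('x \<Rightarrow> 'a) set" where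
  "feasible_obs M C = {f \<in> L2 M. AE x in M. f x \<in> C x}"

subsection \<open>Variational problem and discretisation\<close>

definition energy :: "('v \<Rightarrow> 'v \<Rightarrow> real) \<Rightarrow> ('v \<Rightarrow> real) \<Rightarrow> 'v \<Rightarrow> real" where
  "energy a F v = 1 / 2 * a v v - F v"

definition coupling ::
  "'x measure \<Rightarrow> ('q \<Rightarrow> 'x \<Rightarrow> 'a::euclidean_space) \<Rightarrow> ('v \<Rightarrow> 'q) \<Rightarrow> 'v \<Rightarrow> ('x \<Rightarrow> 'a) \<Rightarrow> real" where
  "coupling M \<iota> B v w = L2_inner M (\<iota> (B v)) w"

definition inf_sup_const ::
  "'x measure \<Rightarrow> ('q::real_normed_vector \<Rightarrow> 'x \<Rightarrow> 'a::euclidean_space) \<Rightarrow>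
   ('v::real_normed_vector \<Rightarrow> 'q) \<Rightarrow> 'v set \<Rightarrow> ('x \<Rightarrow> 'a) set \<Rightarrow> ereal" where
  "inf_sup_const M \<iota> B V W =
     (INF w\<in>{w \<in> W. \<not> (AE x in M. w x = 0)}. SUP v\<in>V - {0}.
        ereal (coupling M \<iota> B v w / (norm v * dual_norm M \<iota> w)))"

definition proximal_galerkin_iterates ::
  "'x measure \<Rightarrow> ('q \<Rightarrow> 'x \<Rightarrow> 'a::euclidean_space) \<Rightarrow> ('v \<Rightarrow> 'q) \<Rightarrow>
   ('v \<Rightarrow> 'v \<Rightarrow> real) \<Rightarrow> ('v \<Rightarrow> real) \<Rightarrow> ('x \<Rightarrow> 'a \<Rightarrow> ereal) \<Rightarrow> 'v set \<Rightarrow> ('x \<Rightarrow> 'a) set \<Rightarrow>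
   (nat \<Rightarrow> real) \<Rightarrow> (nat \<Rightarrow> 'v) \<Rightarrow> (nat \<Rightarrow> 'x \<Rightarrow> 'a) \<Rightarrow> bool" where
  "proximal_galerkin_iterates M \<iota> B a F R V W \<alpha> u \<psi> \<longleftrightarrow>
     \<psi> 0 \<in> W \<and>
     (\<forall>k\<ge>1. u k \<in> V \<and> \<psi> k \<in> W \<and>
        (\<forall>v\<in>V. \<alpha> k * a (u k) v + coupling M \<iota> B v (\<lambda>x. \<psi> k x - \<psi> (k - 1) x) = \<alpha> k * F v) \<and>
        (\<forall>w\<in>W. coupling M \<iota> B (u k) w - L2_inner M (grad_conj_op R (\<psi> k)) w = 0))"

end

theory Submission
  imports Defs
begin

text \<open>The conjugates cancel in the symmetrised divergence, which is the pointwise monotonicity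
  product of the gradient of the conjugate. Testing the second equation of two consecutive steps
  with \<open>\<psi>\<^sup>k\<^sup>+\<^sup>1 - \<psi>\<^sup>k\<close> turns its integral into \<open>b(u\<^sup>k\<^sup>+\<^sup>1 - u\<^sup>k, \<psi>\<^sup>k\<^sup>+\<^sup>1 - \<psi>\<^sup>k)\<close>, which the first
  equation tested with \<open>u\<^sup>k\<^sup>+\<^sup>1 - u\<^sup>k\<close> expresses through \<open>a\<close> and \<open>F\<close>. The energy then drops by
  \<open>a(u\<^sup>k\<^sup>+\<^sup>1 - u\<^sup>k, u\<^sup>k\<^sup>+\<^sup>1 - u\<^sup>k) / 2\<close> more than claimed.\<close>

text \<open>The essential supremum of a null measure is minus infinity, so a real upper bound for it
  may be negative; taking \<open>max 0 K\<close> restores the sign.\<close>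

lemma Linf_AE_bounded:
  assumes "w \<in> Linf \<mu>"
  obtains K where "0 \<le> K" "AE x in \<mu>. norm (w x) \<le> K"
proof -
  have fin: "esssup \<mu> (\<lambda>x. ereal (norm (w x))) < \<infinity>"
    using assms by (auto simp: Linf_def)
  obtain K where "esssup \<mu> (\<lambda>x. ereal (norm (w x))) \<le> ereal K"
    using fin by (cases "esssup \<mu> (\<lambda>x. ereal (norm (w x)))") auto
  moreover have "AE x in \<mu>. ereal (norm (w x)) \<le> esssup \<mu> (\<lambda>x. ereal (norm (w x)))"
    by (rule esssup_AE)
  ultimately have "AE x in \<mu>. norm (w x) \<le> max 0 K"
    by (elim eventually_mono) (metis ereal_less_eq(3) max.coboundedI2 order_trans)
  then show ?thesis using that[of "max 0 K"] by simp
qed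

text \<open>On a finite measure space a square integrable function is integrable, and a bounded
  factor preserves this. It justifies splitting the integrals of the scheme below.\<close>

lemma integrable_inner_L2_Linf:
  assumes "finite_measure \<mu>" "f \<in> L2 \<mu>" "w \<in> Linf \<mu>"
  shows "integrable \<mu> (\<lambda>x. f x \<bullet> w x)"
proof -
  interpret finite_measure \<mu> by fact
  obtain K where K: "0 \<le> K" "AE x in \<mu>. norm (w x) \<le> K"
    using Linf_AE_bounded[OF assms(3)] .
  have [measurable]: "f \<in> borel_measurable \<mu>" "w \<in> borel_measurable \<mu>"
    and f2: "integrable \<mu> (\<lambda>x. (norm (f x))\<^sup>2)"
    using assms by (auto simp: L2_def Linf_def)
  show ?thesis
  proof (rule Bochner_Integration.integrable_bound)
    show "integrable \<mu> (\<lambda>x. (1 + (norm (f x))\<^sup>2) * K)"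
      using f2 by auto
    show "AE x in \<mu>. norm (f x \<bullet> w x) \<le> norm ((1 + (norm (f x))\<^sup>2) * K)"
      using K(2)
    proof eventually_elim
      case (elim x)
      \<comment> \<open>With t the norm, (t - 1)^2 >= 0 gives 1 + t^2 >= 2 t >= t.\<close>
      have "norm (f x) \<le> 1 + (norm (f x))\<^sup>2"
        using zero_le_power2[of "norm (f x) - 1"] norm_ge_zero[of "f x"]
        unfolding power2_diff by (simp del: norm_ge_zero)
      with elim have "norm (f x) * norm (w x) \<le> (1 + (norm (f x))\<^sup>2) * K"
        by (intro mult_mono) auto
      with K(1) Cauchy_Schwarz_ineq2[of "f x" "w x"] show ?case
        by (simp add: abs_mult)
    qed
  qed measurable
qed

lemma L2_inner_diff_left:
  assumes "finite_measure \<mu>" "f \<in> L2 \<mu>" "g \<in> L2 \<mu>" "w \<in> Linf \<mu>"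
  shows "L2_inner \<mu> (\<lambda>x. f x - g x) w = L2_inner \<mu> f w - L2_inner \<mu> g w"
  using assms by (simp add: L2_inner_def inner_diff_left integrable_inner_L2_Linf)

text \<open>Since \<open>\<iota>\<close> picks representatives, it is additive only up to null sets,
  so the difference has to be taken under the integral. Additivity is applied to
  \<open>v = (v - v') + v'\<close>.\<close>

lemma coupling_diff_left:
  assumes "finite_measure \<mu>" and emb: "dense_embedding_L2 \<mu> \<iota>" and B: "linear B"
    and w: "w \<in> Linf \<mu>"
  shows "coupling \<mu> \<iota> B (v - v') w = coupling \<mu> \<iota> B v w - coupling \<mu> \<iota> B v' w"
proof -
  have L2: "\<iota> q \<in> L2 \<mu>" for q
    using emb by (simp add: dense_embedding_L2_def)
  have add: "AE x in \<mu>. \<iota> (p + q) x = \<iota> p x + \<iota> q x" for p q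
    using emb by (simp add: dense_embedding_L2_def)
  have "AE x in \<mu>. \<iota> (B v) x = \<iota> (B (v - v')) x + \<iota> (B v') x"
    using add[of "B (v - v')" "B v'"] B by (simp add: linear_diff)
  then have ae: "AE x in \<mu>. \<iota> (B (v - v')) x \<bullet> w x = (\<iota> (B v) x - \<iota> (B v') x) \<bullet> w x"
    by eventually_elim simp
  have [measurable]: "\<iota> q \<in> borel_measurable \<mu>" "w \<in> borel_measurable \<mu>" for q
    using L2 w by (auto simp: L2_def Linf_def)
  have "coupling \<mu> \<iota> B (v - v') w = L2_inner \<mu> (\<lambda>x. \<iota> (B v) x - \<iota> (B v') x) w"
    unfolding coupling_def L2_inner_def by (rule integral_cong_AE[OF _ _ ae]) measurable
  then show ?thesis
    using assms L2 by (simp add: coupling_def L2_inner_diff_left)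
qed

lemma dual_bregman_symmetrised:
  "dual_bregman R \<eta> \<psi> x + dual_bregman R \<psi> \<eta> x =
     (grad_conj_op R \<eta> x - grad_conj_op R \<psi> x) \<bullet> (\<eta> x - \<psi> x)"
  by (simp add: dual_bregman_def inner_diff_left inner_diff_right)

text \<open>Exact Taylor expansion of the quadratic energy about \<open>v\<close>: the last bracket
  is its derivative there in direction \<open>v - u\<close>. Symmetry of \<open>a\<close> merges the
  two cross terms.\<close>

lemma energy_diff:
  assumes "bilinear a" "\<And>v w. a v w = a w v" "linear F"
  shows "energy a F u = energy a F v + 1 / 2 * a (v - u) (v - u) - (a v (v - u) - F (v - u))"
  using assms(2)[of u v] assms(1,3)
  by (simp add: energy_def bilinear_lsub bilinear_rsub linear_diff field_simps)

lemma fin_dim_subspace_Linf_diff: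
  assumes "fin_dim_subspace_Linf \<mu> S" "f \<in> S" "g \<in> S"
  shows "(\<lambda>x. f x - g x) \<in> S"
proof -
  have add: "\<forall>f\<in>S. \<forall>g\<in>S. (\<lambda>x. f x + g x) \<in> S"
    and scale: "\<forall>c. \<forall>f\<in>S. (\<lambda>x. c *\<^sub>R f x) \<in> S"
    using assms(1) by (simp_all add: fin_dim_subspace_Linf_def)
  have "(\<lambda>x. (-1) *\<^sub>R g x) \<in> S"
    by (rule scale[rule_format, OF assms(3)])
  from add[rule_format, OF assms(2) this] show ?thesis by simp
qed

theorem lemma3p2:
  fixes \<Omega> \<Omega>\<^sub>d :: "(real^'n) set" and d :: real
    and \<mu> :: "(real^'n) measure"
    and B :: "'v::{real_inner, complete_space} \<Rightarrow> 'q::{real_inner, complete_space}"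
    and \<iota> :: "'q \<Rightarrow> real^'n \<Rightarrow> real^'m"
    and C :: "real^'n \<Rightarrow> (real^'m) set"
    and R :: "real^'n \<Rightarrow> real^'m \<Rightarrow> ereal"
    and a :: "'v \<Rightarrow> 'v \<Rightarrow> real" and F :: "'v \<Rightarrow> real" and \<nu> M :: real
    and V\<^sub>h :: "'h \<Rightarrow> 'v set" and W\<^sub>h :: "'h \<Rightarrow> (real^'n \<Rightarrow> real^'m) set"
    and \<beta> :: "'h \<Rightarrow> ereal" and \<beta>\<^sub>0 :: real and h :: 'h
    and \<alpha> :: "nat \<Rightarrow> real" and u :: "nat \<Rightarrow> 'v" and \<psi> :: "nat \<Rightarrow> real^'n \<Rightarrow> real^'m"
  assumes n: "CARD('n) \<in> {1, 2, 3}"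
    and domain: "polyhedral_domain \<Omega>"
    and obs_subset: "\<Omega>\<^sub>d \<subseteq> closure \<Omega>"
    and obs_dim: "hausdorff_dim \<Omega>\<^sub>d = d" "d \<le> real CARD('n)"
    and obs_meas: "\<Omega>\<^sub>d \<in> sets (hausdorff_measure d)"
    and obs_finite: "emeasure (hausdorff_measure d) \<Omega>\<^sub>d < \<infinity>"
    and mu: "\<mu> = restrict_space (hausdorff_measure d) \<Omega>\<^sub>d"
    and B: "bounded_linear B" "surj B"
    and embedding: "dense_embedding_L2 \<mu> \<iota>"
    and C: "AE x in \<mu>. closed (C x) \<and> convex (C x) \<and> interior (C x) \<noteq> {}"
    and a_bilinear: "bilinear a"
    and a_sym: "\<And>v w. a v w = a w v"
    and \<nu>_M: "0 < \<nu>" "0 < M"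
    and a_coercive: "\<And>v. \<nu> * (norm v)\<^sup>2 \<le> a v v"
    and a_bounded: "\<And>v w. a v w \<le> M * norm v * norm w"
    and F: "bounded_linear F"
    and R_caratheodory: "caratheodory_fun \<mu> R"
    and R_legendre: "AE x in \<mu>. legendre (R x) \<and> eff_dom (R x) = C x \<and> supercoercive (R x)"
    and R_L1: "\<forall>w\<in>feasible_obs \<mu> C. superpos_in_L1 \<mu> R w"
    and R_cont: "continuous_wrt (L2_dist \<mu>) (L1_dist \<mu>) (feasible_obs \<mu> C) (superpos R)"
    and R_conj_L1: "\<forall>\<eta>\<in>Linf \<mu>. superpos_in_L1 \<mu> (\<lambda>x. fenchel_conjugate (R x)) \<eta>"
    and R_grad_obs: "\<forall>\<eta>\<in>Linf \<mu>. grad_conj_op R \<eta> \<in> feasible_obs \<mu> C"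
    and R_grad_cont: "continuous_wrt (Linf_dist \<mu>) (L2_dist \<mu>) (Linf \<mu>) (grad_conj_op R)"
    and V\<^sub>h: "\<And>h. subspace (V\<^sub>h h) \<and> (\<exists>S. finite S \<and> span S = V\<^sub>h h)"
    and W\<^sub>h: "\<And>h. fin_dim_subspace_Linf \<mu> (W\<^sub>h h)"
    and inf_sup: "\<And>h. inf_sup_const \<mu> \<iota> B (V\<^sub>h h) (W\<^sub>h h) = \<beta> h" "\<And>h. ereal \<beta>\<^sub>0 < \<beta> h" "0 < \<beta>\<^sub>0"
    and \<alpha>_pos: "\<And>k. 1 \<le> k \<Longrightarrow> 0 < \<alpha> k"
    and \<alpha>_sum: "filterlim (\<lambda>N. \<Sum>k=1..N. \<alpha> k) at_top sequentially"
    and iterates: "proximal_galerkin_iterates \<mu> \<iota> B a F R (V\<^sub>h h) (W\<^sub>h h) \<alpha> u \<psi>"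
  shows "\<forall>k\<ge>1.
      energy a F (u (k + 1)) +
        1 / \<alpha> (k + 1) *
          (LINT x|\<mu>. dual_bregman R (\<psi> (k + 1)) (\<psi> k) x + dual_bregman R (\<psi> k) (\<psi> (k + 1)) x)
      \<le> energy a F (u k)"
proof (intro allI impI)
  fix k :: nat assume k: "1 \<le> k"
  define w where "w = (\<lambda>x. \<psi> (k + 1) x - \<psi> k x)"
  define e where "e = u (k + 1) - u k"
  have fin: "finite_measure \<mu>"
    using obs_finite obs_meas
    by (intro finite_measureI) (simp add: mu space_restrict_space space_hausdorff_measure
        emeasure_restrict_space)
  \<comment> \<open>The equations start at index 1 because \<open>\<psi> 0\<close> is only an
    initial guess. Both \<open>k\<close> and \<open>k + 1\<close> are used below, hence
    \<open>1 \<le> k\<close>.\<close>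
  have it: "u j \<in> V\<^sub>h h" "\<psi> j \<in> W\<^sub>h h"
    "\<And>v. v \<in> V\<^sub>h h \<Longrightarrow>
      \<alpha> j * a (u j) v + coupling \<mu> \<iota> B v (\<lambda>x. \<psi> j x - \<psi> (j - 1) x) = \<alpha> j * F v"
    "\<And>z. z \<in> W\<^sub>h h \<Longrightarrow> coupling \<mu> \<iota> B (u j) z = L2_inner \<mu> (grad_conj_op R (\<psi> j)) z"
    if "1 \<le> j" for j
    using iterates that by (auto simp: proximal_galerkin_iterates_def)
  have w: "w \<in> W\<^sub>h h"
    unfolding w_def using k by (intro fin_dim_subspace_Linf_diff[OF W\<^sub>h] it) auto
  have Linf: "z \<in> Linf \<mu>" if "z \<in> W\<^sub>h h" for z
    using W\<^sub>h[of h] that by (auto simp: fin_dim_subspace_Linf_def)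
  have grad: "grad_conj_op R (\<psi> j) \<in> L2 \<mu>" if "1 \<le> j" for j
    using R_grad_obs Linf it(2)[OF that] by (auto simp: feasible_obs_def)
  have e: "e \<in> V\<^sub>h h"
    unfolding e_def using V\<^sub>h[of h] k by (intro subspace_diff it) auto
  let ?I = "LINT x|\<mu>. dual_bregman R (\<psi> (k + 1)) (\<psi> k) x + dual_bregman R (\<psi> k) (\<psi> (k + 1)) x"
  have "?I = L2_inner \<mu> (\<lambda>x. grad_conj_op R (\<psi> (k + 1)) x - grad_conj_op R (\<psi> k) x) w"
    by (simp only: dual_bregman_symmetrised L2_inner_def w_def)
  \<comment> \<open>The second equation is used at both levels with the same test function
    \<open>w\<close>.\<close>
  also have "\<dots> = coupling \<mu> \<iota> B (u (k + 1)) w - coupling \<mu> \<iota> B (u k) w"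
    using k L2_inner_diff_left[OF fin grad grad Linf[OF w], of "k + 1" k]
      it(4)[OF _ w, of "k + 1"] it(4)[OF _ w, of k] by simp
  also have "\<dots> = coupling \<mu> \<iota> B e w"
    unfolding e_def
    by (rule coupling_diff_left[OF fin embedding bounded_linear.linear[OF B(1)] Linf[OF w], symmetric])
  \<comment> \<open>In the first equation at level \<open>k + 1\<close> the increment of
    \<open>\<psi>\<close> is exactly \<open>w\<close>.\<close>
  also have "\<dots> = \<alpha> (k + 1) * (F e - a (u (k + 1)) e)"
    using it(3)[OF _ e, of "k + 1"] by (simp add: w_def algebra_simps)
  finally have I: "1 / \<alpha> (k + 1) * ?I = F e - a (u (k + 1)) e"
    using \<alpha>_pos[of "k + 1"] by simp
  have "0 \<le> \<nu> * (norm e)\<^sup>2"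
    using \<nu>_M by simp
  also have "\<dots> \<le> a e e"
    by (rule a_coercive)
  \<comment> \<open>Expanding about the new iterate \<open>u (k + 1)\<close> makes the first-order
    term equal to the scaled divergence, leaving the nonnegative surplus
    \<open>1 / 2 * a e e\<close>.\<close>
  finally show "energy a F (u (k + 1)) + 1 / \<alpha> (k + 1) * ?I \<le> energy a F (u k)"
    unfolding I using energy_diff[OF a_bilinear a_sym bounded_linear.linear[OF F], of "u k" "u (k + 1)"]
    unfolding e_def[symmetric] by linarith
qed

end
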